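(* Let $D=\sum_{1\le p,q\le d}l_{p,q}x_q\triangle_p\nabla_q+\sum_{p=1}^d(-x_p+s_p)\triangle_p$, with coefficients satisfying the assumptions listed in the context. Assume that $l_{i,j}=0$ for some $1\le i\ne j\le d$. Define $I=\{i\}\cup\{m:l_{m,i}\neq0\}$ and $J=\{1,2,\dots,d\}\setminus I\supset\{j\}$. Then $D=D_I+D_J$, where $D_I$ is an admissible operator in the variables $\{x_m:m\in I\}$ and $D_J$ is an admissible operator in the variables $\{x_k:k\in J\}$.
   Context: $d>1$, $\{e_1,\dots,e_d\}$ is the standard basis of $\mathbb{R}^d$, $E_pf(x)=f(x+e_p)$, $\triangle_p=E_p-\mathrm{Id}$, $\nabla_p=\mathrm{Id}-E_p^{-1}$; $l_{p,q}$, $s_p$ are real constants. Writing $D=\sum_{p\ne q}\alpha_{p,q}E_pE_q^{-1}+\sum_p\beta_pE_p+\sum_p\gamma_pE_p^{-1}+\delta\,\mathrm{Id}$ one has $$\alpha_{p,q}=-l_{p,q}x_q\ (p\neq q),\quad \beta_p=\sum_{k\ne p}l_{p,k}x_k+(l_{p,p}-1)x_p+s_p,\quad \gamma_p=x_p\sum_{k=1}^dl_{k,p}.$$ Assumptions: (a) the compatibility conditions hold as polynomial identities for all $p\ne q$: $$\alpha_{p,q}(x-e_p)\beta_q(x-e_q)\gamma_p(x)=\alpha_{q,p}(x-e_q)\beta_p(x-e_p)\gamma_q(x),$$ $$\beta_p(x-e_p)\beta_q(x-e_p-e_q)\gamma_q(x)\gamma_p(x-e_q)=\beta_q(x-e_q)\beta_p(x-e_p-e_q)\gamma_p(x)\gamma_q(x-e_p);$$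 (b) $\gamma_p$ is not identically zero for every $p$; (c) for $p\ne q$, $l_{p,q}=0$ if and only if $l_{q,p}=0$ (a consequence of self-adjointness of $D$ with respect to a positive weight). An operator "in the variables $\{x_m:m\in I\}$" is a difference operator of the form $\sum_{m,m'\in I}A_{m,m'}\triangle_m\nabla_{m'}+\sum_{m\in I}B_m\triangle_m$ whose coefficients depend only on $\{x_m:m\in I\}$. Such an operator is called admissible if for every $k\in\mathbb{N}_0$ there is a number $\lambda_k$ such that the equation $D_Iu=\lambda_ku$ has $\binom{k+|I|-1}{k}$ (the number of monomials of degree $k$ in $|I|$ variables) linearly independent polynomial solutions of degree $k$ in the variables $\{x_m:m\in I\}$ and no nontrivial solutions among polynomials of degree less than $k$; similarly for $J$. *)

theory Defs
  imports "HOL-Analysis.Analysis" "HOL-Library.Function_Algebras"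
begin

section \<open>Real-valued functions as a vector space\<close>

text \<open>
  The library provides pointwise addition and zero of functions, but no scalar multiplication.
\<close>

definition fscale :: "real \<Rightarrow> ('a \<Rightarrow> real) \<Rightarrow> 'a \<Rightarrow> real" where
  "fscale c f = (\<lambda>x. c * f x)"

global_interpretation fun_space: vector_space "fscale :: real \<Rightarrow> ('a \<Rightarrow> real) \<Rightarrow> 'a \<Rightarrow> real"
  by unfold_locales (auto simp: fscale_def fun_eq_iff algebra_simps)

section \<open>Difference operators\<close>

type_synonym 'n func = "real ^ 'n \<Rightarrow> real"

definition shift :: "'n::finite \<Rightarrow> 'n func \<Rightarrow> 'n func" where
  "shift p f = (\<lambda>x. f (x + axis p 1))"

definition shift_inv :: "'n::finite \<Rightarrow> 'n func \<Rightarrow> 'n func" where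
  "shift_inv p f = (\<lambda>x. f (x - axis p 1))"

definition forward_diff :: "'n::finite \<Rightarrow> 'n func \<Rightarrow> 'n func" where
  "forward_diff p f = (\<lambda>x. shift p f x - f x)"

definition backward_diff :: "'n::finite \<Rightarrow> 'n func \<Rightarrow> 'n func" where
  "backward_diff p f = (\<lambda>x. f x - shift_inv p f x)"

lemma shift_shift_inv: "shift p (shift_inv p f) = f" "shift_inv p (shift p f) = f"
  by (simp_all add: shift_def shift_inv_def)

definition depends_only_on :: "'n::finite set \<Rightarrow> 'n func \<Rightarrow> bool" where
  "depends_only_on I f \<longleftrightarrow> (\<forall>x y. (\<forall>m\<in>I. x $ m = y $ m) \<longrightarrow> f x = f y)"

definition difference_operator_in :: "'n::finite set \<Rightarrow> ('n func \<Rightarrow> 'n func) \<Rightarrow> bool" where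
  "difference_operator_in I T \<longleftrightarrow>
     (\<exists>A B. (\<forall>m\<in>I. \<forall>m'\<in>I. depends_only_on I (A m m')) \<and> (\<forall>m\<in>I. depends_only_on I (B m)) \<and>
        T = (\<lambda>f x. (\<Sum>m\<in>I. \<Sum>m'\<in>I. A m m' x * forward_diff m (backward_diff m' f) x)
                 + (\<Sum>m\<in>I. B m x * forward_diff m f x)))"

section \<open>Polynomials in a subset of the variables\<close>

text \<open>
  Since the real field is infinite, polynomials are identified with polynomial functions.  The set
  \<open>polys_less I k\<close> consists of the polynomials of total degree less than \<open>k\<close> (including zero) in
  the variables indexed by \<open>I\<close>, regarded as functions on the whole space; \<open>polys_of_degree I k\<close>
  consists of those of total degree exactly \<open>k\<close>, so it never contains zero.
\<close>

definition monomial_in :: "'n::finite set \<Rightarrow> ('n \<Rightarrow> nat) \<Rightarrow> 'n func" where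
  "monomial_in I \<nu> = (\<lambda>x. \<Prod>m\<in>I. (x $ m) ^ \<nu> m)"

definition polys_less :: "'n::finite set \<Rightarrow> nat \<Rightarrow> 'n func set" where
  "polys_less I k = fun_space.span {monomial_in I \<nu> | \<nu>. (\<Sum>m\<in>I. \<nu> m) < k}"

definition polys_of_degree :: "'n::finite set \<Rightarrow> nat \<Rightarrow> 'n func set" where
  "polys_of_degree I k = polys_less I (Suc k) - polys_less I k"

section \<open>Admissible operators\<close>

definition admissible :: "'n::finite set \<Rightarrow> ('n func \<Rightarrow> 'n func) \<Rightarrow> bool" where
  "admissible I T \<longleftrightarrow> difference_operator_in I T \<and>
     (\<forall>k::nat. \<exists>\<mu>::real.
        (\<exists>U. finite U \<and> card U = (k + card I - 1) choose k \<and> fun_space.independent U \<and>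
             (\<forall>u\<in>U. u \<in> polys_of_degree I k \<and> T u = fscale \<mu> u)) \<and>
        (\<forall>u\<in>polys_less I k. T u = fscale \<mu> u \<longrightarrow> u = 0))"

section \<open>The operator and its shift coefficients\<close>

definition D_op :: "('n::finite \<Rightarrow> 'n \<Rightarrow> real) \<Rightarrow> ('n \<Rightarrow> real) \<Rightarrow> 'n func \<Rightarrow> 'n func" where
  "D_op l s = (\<lambda>f x. (\<Sum>p\<in>UNIV. \<Sum>q\<in>UNIV. l p q * x $ q * forward_diff p (backward_diff q f) x)
                    + (\<Sum>p\<in>UNIV. (- (x $ p) + s p) * forward_diff p f x))"

text \<open>Only the values of \<open>coeff_alpha l p q\<close> with \<open>p \<noteq> q\<close> are meaningful.\<close>

definition coeff_alpha :: "('n::finite \<Rightarrow> 'n \<Rightarrow> real) \<Rightarrow> 'n \<Rightarrow> 'n \<Rightarrow> 'n func" where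
  "coeff_alpha l p q = (\<lambda>x. - l p q * x $ q)"

definition coeff_beta :: "('n::finite \<Rightarrow> 'n \<Rightarrow> real) \<Rightarrow> ('n \<Rightarrow> real) \<Rightarrow> 'n \<Rightarrow> 'n func" where
  "coeff_beta l s p = (\<lambda>x. (\<Sum>k\<in>UNIV - {p}. l p k * x $ k) + (l p p - 1) * x $ p + s p)"

definition coeff_gamma :: "('n::finite \<Rightarrow> 'n \<Rightarrow> real) \<Rightarrow> 'n \<Rightarrow> 'n func" where
  "coeff_gamma l p = (\<lambda>x. x $ p * (\<Sum>k\<in>UNIV. l k p))"

lemma D_op_shift_form:
  fixes l :: "'n::finite \<Rightarrow> 'n \<Rightarrow> real"
  shows "\<exists>\<delta>. \<forall>f x. D_op l s f x =
     (\<Sum>p\<in>UNIV. \<Sum>q\<in>UNIV - {p}. coeff_alpha l p q x * shift p (shift_inv q f) x)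
     + (\<Sum>p\<in>UNIV. coeff_beta l s p x * shift p f x)
     + (\<Sum>p\<in>UNIV. coeff_gamma l p x * shift_inv p f x) + \<delta> x * f x"
proof -
  define \<delta> where "\<delta> = (\<lambda>x::real^'n. - (\<Sum>p\<in>UNIV. \<Sum>q\<in>UNIV. l p q * x $ q)
      - (\<Sum>p\<in>UNIV. - (x $ p) + s p) - (\<Sum>p\<in>UNIV. l p p * x $ p))"
  have "D_op l s f x =
     (\<Sum>p\<in>UNIV. \<Sum>q\<in>UNIV - {p}. coeff_alpha l p q x * shift p (shift_inv q f) x)
     + (\<Sum>p\<in>UNIV. coeff_beta l s p x * shift p f x)
     + (\<Sum>p\<in>UNIV. coeff_gamma l p x * shift_inv p f x) + \<delta> x * f x" for f x
  proof -
    have a: "(\<Sum>q\<in>UNIV - {p}. coeff_alpha l p q x * shift p (shift_inv q f) x)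
        = - (\<Sum>q\<in>UNIV. l p q * x $ q * shift p (shift_inv q f) x) + l p p * x $ p * f x" for p
      by (simp add: sum.remove[of UNIV p] coeff_alpha_def shift_shift_inv sum_negf)
    have b: "coeff_beta l s p x = (\<Sum>q\<in>UNIV. l p q * x $ q) - x $ p + s p" for p
      by (simp add: sum.remove[of UNIV p] coeff_beta_def algebra_simps)
    have c: "(\<Sum>p\<in>UNIV. coeff_gamma l p x * shift_inv p f x)
        = (\<Sum>p\<in>UNIV. \<Sum>q\<in>UNIV. l p q * x $ q * shift_inv q f x)"
      by (subst sum.swap) (simp add: coeff_gamma_def sum_distrib_left sum_distrib_right mult_ac)
    have d: "forward_diff p (backward_diff q f) x
        = shift p f x - shift p (shift_inv q f) x - f x + shift_inv q f x" for p q
      by (simp add: forward_diff_def backward_diff_def shift_def)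
    show ?thesis
      unfolding D_op_def a b c d \<delta>_def
      by (simp add: forward_diff_def algebra_simps sum.distrib sum_subtractf sum_negf
          sum_distrib_left sum_distrib_right)
  qed
  then show ?thesis by blast
qed

end

theory Submission
  imports Defs
begin

text \<open>
  Write \<open>c\<^sub>p\<close> for the column sum of \<open>l\<close> with \<open>\<gamma>\<^sub>p = c\<^sub>p x\<^sub>p\<close>; by assumption \<open>c\<^sub>p \<noteq> 0\<close>.  Cancelling \<open>x\<^sub>p x\<^sub>q\<close>
  in the first compatibility condition gives
  \<open>l\<^sub>p\<^sub>q c\<^sub>p \<beta>\<^sub>q(x - e\<^sub>q) = l\<^sub>q\<^sub>p c\<^sub>q \<beta>\<^sub>p(x - e\<^sub>p)\<close>, and comparing the coefficients of a third variable \<open>x\<^sub>k\<close>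
  gives \<open>l\<^sub>p\<^sub>q c\<^sub>p l\<^sub>q\<^sub>k = l\<^sub>q\<^sub>p c\<^sub>q l\<^sub>p\<^sub>k\<close>.  Together with the symmetry of the zero pattern of \<open>l\<close>, this makes
  the relation ``\<open>p = q\<close> or \<open>l\<^sub>p\<^sub>q \<noteq> 0\<close>'' an equivalence relation, in which \<open>I\<close> is the class of
  \<open>i\<close>.  Hence \<open>l\<close> is block diagonal with respect to \<open>I\<close> and \<open>J\<close>, and \<open>D\<close> is the sum of its two
  blocks (lemma \<open>D_op_split\<close>).

  Each block is admissible for a reason that involves no compatibility at all (lemma
  \<open>block_op_admissible\<close>).  The terms \<open>l\<^sub>p\<^sub>q x\<^sub>q \<triangle>\<^sub>p \<nabla>\<^sub>q\<close> and \<open>s\<^sub>p \<triangle>\<^sub>p\<close> lower the degree, while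
  \<open>\<Sum> x\<^sub>p \<triangle>\<^sub>p\<close> is, up to terms of lower degree, the Euler operator.  So the block acts on
  polynomials of degree at most \<open>k\<close> as multiplication by \<open>-k\<close> modulo polynomials of degree less
  than \<open>k\<close>.  It is therefore triangular with the distinct eigenvalues \<open>0, -1, -2, \<dots>\<close>: the
  operator shifted by \<open>k\<close> is bijective on polynomials of degree less than \<open>k\<close>, and every
  monomial of degree \<open>k\<close> can be completed by lower terms to an eigenfunction for \<open>-k\<close>.  These
  eigenfunctions are linearly independent because the monomials are.
\<close>

section \<open>Monomials\<close>

text \<open>
  Linear independence of monomial functions, by induction on the set of variables: in one variable
  \<open>x\<^sub>m\<close>, with the others fixed, the sum is a univariate polynomial that vanishes identically, and each
  of its coefficients is a combination of monomials in the remaining variables.  The exponents in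
  \<open>S\<close> only have to be distinguished by their values on \<open>I\<close>; this formulation passes to the subset of
  exponents with a given value at \<open>m\<close> without changing the exponents.
\<close>

lemma monomial_functions_coeff_zero:
  fixes c :: "('n::finite \<Rightarrow> nat) \<Rightarrow> real"
  assumes "finite I" "finite S"
    and "\<And>\<nu> \<mu>. \<nu> \<in> S \<Longrightarrow> \<mu> \<in> S \<Longrightarrow> (\<And>m. m \<in> I \<Longrightarrow> \<nu> m = \<mu> m) \<Longrightarrow> \<nu> = \<mu>"
    and "\<And>x. (\<Sum>\<nu>\<in>S. c \<nu> * monomial_in I \<nu> x) = 0"
    and "\<nu> \<in> S"
  shows "c \<nu> = 0"
  using assms
proof (induction I arbitrary: S \<nu> rule: finite_induct)
  case empty
  then have "S = {\<nu>}" by blast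
  with empty.prems(3) show ?case by (simp add: monomial_in_def)
next
  case (insert m I)
  let ?S = "{\<mu> \<in> S. \<mu> m = \<nu> m}"
  have "(\<Sum>\<mu>\<in>?S. c \<mu> * monomial_in I \<mu> x) = 0" for x
  proof -
    define P where "P = (\<Sum>\<mu>\<in>S. monom (c \<mu> * monomial_in I \<mu> x) (\<mu> m))"
    have "poly P t = 0" for t
    proof -
      define y where "y = (\<chi> n. if n = m then t else x $ n)"
      have "monomial_in (insert m I) \<mu> y = t ^ \<mu> m * monomial_in I \<mu> x" for \<mu>
      proof -
        have "(\<Prod>n\<in>I. y $ n ^ \<mu> n) = (\<Prod>n\<in>I. x $ n ^ \<mu> n)"
          using insert.hyps by (intro prod.cong) (auto simp: y_def)
        then show ?thesis
          using insert.hyps by (simp add: monomial_in_def y_def)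
      qed
      then have "poly P t = (\<Sum>\<mu>\<in>S. c \<mu> * monomial_in (insert m I) \<mu> y)"
        by (simp add: P_def poly_sum poly_monom mult_ac)
      with insert.prems(3) show ?thesis by simp
    qed
    then have "P = 0" by (simp add: poly_all_0_iff_0[symmetric])
    then have "coeff P (\<nu> m) = 0" by simp
    then show ?thesis
      using insert.prems(1) by (simp add: P_def coeff_sum sum.inter_filter)
  qed
  moreover have "\<mu> = \<mu>'"
    if "\<mu> \<in> ?S" "\<mu>' \<in> ?S" "\<And>n. n \<in> I \<Longrightarrow> \<mu> n = \<mu>' n" for \<mu> \<mu>'
    using that by (intro insert.prems(2)) auto
  ultimately show ?case
    using insert.prems(1,4) by (intro insert.IH[of ?S]) auto
qed

text \<open>
  Only the values of an exponent on \<open>I\<close> matter for \<open>monomial_in I\<close>.  Exponents that vanish outside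
  \<open>I\<close> are used as normal forms, so that distinct exponents give distinct monomials.
\<close>

definition exponents :: "'n::finite set \<Rightarrow> ('n \<Rightarrow> nat) set" where
  "exponents I = {\<nu>. \<forall>m. m \<notin> I \<longrightarrow> \<nu> m = 0}"

lemma exponents_eqI:
  assumes "\<nu> \<in> exponents I" "\<mu> \<in> exponents I" "\<And>m. m \<in> I \<Longrightarrow> \<nu> m = \<mu> m"
  shows "\<nu> = \<mu>"
proof
  show "\<nu> m = \<mu> m" for m using assms by (cases "m \<in> I") (auto simp: exponents_def)
qed

lemma monomial_in_normal_form:
  obtains \<mu> where "\<mu> \<in> exponents I" "monomial_in I \<nu> = monomial_in I \<mu>"
    "(\<Sum>m\<in>I. \<nu> m) = (\<Sum>m\<in>I. \<mu> m)"
proof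
  let ?\<mu> = "\<lambda>m. if m \<in> I then \<nu> m else 0"
  show "?\<mu> \<in> exponents I" by (simp add: exponents_def)
  show "monomial_in I \<nu> = monomial_in I ?\<mu>"
    unfolding monomial_in_def by (intro ext prod.cong) auto
  show "(\<Sum>m\<in>I. \<nu> m) = (\<Sum>m\<in>I. ?\<mu> m)" by (intro sum.cong) auto
qed

lemma fun_sum_apply: "(\<Sum>a\<in>A. (f a :: 'b \<Rightarrow> real)) x = (\<Sum>a\<in>A. f a x)"
  by (induction A rule: infinite_finite_induct) auto

lemma inj_on_monomial_in: "inj_on (monomial_in I) (exponents I)"
proof (rule inj_onI, rule ccontr)
  fix \<nu> \<mu> :: "'a \<Rightarrow> nat"
  assume *: "\<nu> \<in> exponents I" "\<mu> \<in> exponents I" "monomial_in I \<nu> = monomial_in I \<mu>" "\<nu> \<noteq> \<mu>"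
  let ?c = "\<lambda>\<kappa>. if \<kappa> = \<nu> then 1 else - 1 :: real"
  have "?c \<nu> = 0"
  proof (rule monomial_functions_coeff_zero[of I "{\<nu>, \<mu>}" ?c])
    show "\<kappa> = \<kappa>'" if "\<kappa> \<in> {\<nu>, \<mu>}" "\<kappa>' \<in> {\<nu>, \<mu>}" "\<And>m. m \<in> I \<Longrightarrow> \<kappa> m = \<kappa>' m" for \<kappa> \<kappa>'
      using that * exponents_eqI[of \<kappa> I \<kappa>'] by auto
  qed (use * in auto)
  then show False by simp
qed

lemma independent_monomials: "fun_space.independent (monomial_in I ` exponents I)"
proof -
  have "\<not> fun_space.dependent M" if M: "finite M" "M \<subseteq> monomial_in I ` exponents I" for M
  proof (rule fun_space.independent_if_scalars_zero[OF M(1)])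
    fix c f assume 0: "(\<Sum>f\<in>M. fscale (c f) f) = 0" and "f \<in> M"
    obtain S where S: "S \<subseteq> exponents I" "M = monomial_in I ` S"
      using M(2) by (auto simp: subset_image_iff)
    have inj: "inj_on (monomial_in I) S"
      using inj_on_monomial_in S(1) inj_on_subset by blast
    obtain \<nu> where \<nu>: "\<nu> \<in> S" "f = monomial_in I \<nu>" using \<open>f \<in> M\<close> S(2) by blast
    have "c (monomial_in I \<nu>) = 0"
    proof (rule monomial_functions_coeff_zero[of I S "\<lambda>\<nu>. c (monomial_in I \<nu>)"])
      show "finite S" using M(1) S(2) inj by (simp add: finite_image_iff)
      show "(\<Sum>\<nu>\<in>S. c (monomial_in I \<nu>) * monomial_in I \<nu> x) = 0" for x
        using fun_cong[OF 0, of x]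
        by (simp add: S(2) sum.reindex[OF inj] fun_sum_apply fscale_def)
      show "\<kappa> = \<kappa>'" if "\<kappa> \<in> S" "\<kappa>' \<in> S" "\<And>m. m \<in> I \<Longrightarrow> \<kappa> m = \<kappa>' m" for \<kappa> \<kappa>'
        using that S(1) exponents_eqI[of \<kappa> I \<kappa>'] by blast
    qed (use \<nu> in auto)
    then show "c f = 0" by (simp add: \<nu>(2))
  qed
  then show ?thesis
    unfolding fun_space.dependent_explicit by blast
qed

lemma card_exponents_of_degree:
  assumes "I \<noteq> {}"
  shows "finite {\<nu> \<in> exponents I. (\<Sum>m\<in>I. \<nu> m) = k}"
    and "card {\<nu> \<in> exponents I. (\<Sum>m\<in>I. \<nu> m) = k} = (k + card I - 1) choose k"
proof -
  obtain ms where ms: "set ms = I" "distinct ms"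
    using finite_distinct_list[of I] by auto
  then have len: "length ms = card I" using distinct_card by fastforce
  let ?N = "{\<nu> \<in> exponents I. (\<Sum>m\<in>I. \<nu> m) = k}"
  let ?L = "{ns. length ns = card I \<and> sum_list ns = k}"
  have "bij_betw (\<lambda>\<nu>. map \<nu> ms) ?N ?L"
    unfolding bij_betw_def
  proof (intro conjI equalityI subsetI)
    show "inj_on (\<lambda>\<nu>. map \<nu> ms) ?N"
      by (intro inj_onI exponents_eqI[of _ I]) (auto simp: ms(1)[symmetric])
  next
    fix ns assume "ns \<in> (\<lambda>\<nu>. map \<nu> ms) ` ?N"
    then show "ns \<in> ?L"
      using ms len by (auto simp: sum_list_distinct_conv_sum_set)
  next
    fix ns assume ns: "ns \<in> ?L"
    define \<nu> where "\<nu> m = (case map_of (zip ms ns) m of None \<Rightarrow> 0 | Some a \<Rightarrow> a)" for m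
    have map: "map \<nu> ms = ns"
      using ns len ms(2) by (auto intro!: nth_equalityI simp: \<nu>_def map_of_zip_nth)
    moreover have "\<nu> \<in> exponents I"
      using ms(1) ns len by (auto simp: exponents_def \<nu>_def split: option.splits
          dest!: map_of_SomeD set_zip_leftD)
    moreover have "(\<Sum>m\<in>I. \<nu> m) = k"
      using ns map ms sum_list_distinct_conv_sum_set[of ms \<nu>] by simp
    ultimately show "ns \<in> (\<lambda>\<nu>. map \<nu> ms) ` ?N" by force
  qed
  moreover have "card ?L = (k + card I - 1) choose k"
    by (rule card_length_sum_list)
  moreover have "finite ?L"
  proof (rule finite_subset)
    show "?L \<subseteq> {ns. set ns \<subseteq> {..k} \<and> length ns = card I}"
      using member_le_sum_list by fastforce
    show "finite {ns. set ns \<subseteq> {..k} \<and> length ns = card I}"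
      by (rule finite_lists_length_eq) simp
  qed
  ultimately show "finite ?N" "card ?N = (k + card I - 1) choose k"
    by (simp_all add: bij_betw_finite bij_betw_same_card)
qed

section \<open>Degree filtration and difference operators\<close>

lemma polys_less_0 [simp]: "polys_less I 0 = {0}"
  by (simp add: polys_less_def)

lemma polys_less_add: "f \<in> polys_less I k \<Longrightarrow> g \<in> polys_less I k \<Longrightarrow> f + g \<in> polys_less I k"
  unfolding polys_less_def by (rule fun_space.span_add)

lemma polys_less_diff: "f \<in> polys_less I k \<Longrightarrow> g \<in> polys_less I k \<Longrightarrow> f - g \<in> polys_less I k"
  unfolding polys_less_def by (rule fun_space.span_diff)

lemma polys_less_scale: "f \<in> polys_less I k \<Longrightarrow> fscale c f \<in> polys_less I k"
  unfolding polys_less_def by (rule fun_space.span_scale)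

lemma polys_less_sum: "(\<And>a. a \<in> A \<Longrightarrow> f a \<in> polys_less I k) \<Longrightarrow> (\<Sum>a\<in>A. f a) \<in> polys_less I k"
  unfolding polys_less_def by (rule fun_space.span_sum)

lemma monomial_in_polys_less: "(\<Sum>m\<in>I. \<nu> m) < k \<Longrightarrow> monomial_in I \<nu> \<in> polys_less I k"
  unfolding polys_less_def by (blast intro: fun_space.span_base)

lemma polys_less_mono: "j \<le> k \<Longrightarrow> polys_less I j \<subseteq> polys_less I k"
  unfolding polys_less_def by (rule fun_space.span_mono) force

text \<open>Linearity over the reals, for operators on functions.\<close>

definition linear_op :: "('n func \<Rightarrow> 'n func) \<Rightarrow> bool" where
  "linear_op T \<longleftrightarrow> (\<forall>f g. T (f + g) = T f + T g) \<and> (\<forall>c f. T (fscale c f) = fscale c (T f))"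

lemma linear_op_zero: "linear_op T \<Longrightarrow> T 0 = 0"
  unfolding linear_op_def by (metis fun_space.scale_zero_left)

lemma linear_op_diff:
  assumes "linear_op T" shows "T (f - g) = T f - T g"
proof -
  have "T (f - g) + T g = T f" using assms unfolding linear_op_def by (metis diff_add_cancel)
  then show ?thesis by (metis add_diff_cancel)
qed

lemma linear_op_polys_less:
  assumes T: "linear_op T"
    and mon: "\<And>\<nu>. (\<Sum>m\<in>I. \<nu> m) < k \<Longrightarrow> T (monomial_in I \<nu>) \<in> polys_less I k'"
    and f: "f \<in> polys_less I k"
  shows "T f \<in> polys_less I k'"
  using f unfolding polys_less_def[of I k]
proof (induction rule: fun_space.span_induct_alt)
  case base
  show ?case unfolding linear_op_zero[OF T] polys_less_def by (rule fun_space.span_zero)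
next
  case (step c g f)
  then have "T g \<in> polys_less I k'" using mon by auto
  then have "fscale c (T g) + T f \<in> polys_less I k'"
    using step by (intro polys_less_add polys_less_scale)
  also have "fscale c (T g) + T f = T (fscale c g + f)" using T by (simp add: linear_op_def)
  finally show ?case .
qed

text \<open>Multiplication by the coordinate function \<open>x\<^sub>q\<close>.\<close>

definition mult_var :: "'n::finite \<Rightarrow> 'n func \<Rightarrow> 'n func" where
  "mult_var q f = (\<lambda>x. x $ q * f x)"

lemma linear_op_mult_var: "linear_op (mult_var q)"
  by (auto simp: linear_op_def mult_var_def fscale_def fun_eq_iff algebra_simps)

lemma linear_op_forward_diff: "linear_op (forward_diff p)"
  by (auto simp: linear_op_def forward_diff_def shift_def fscale_def fun_eq_iff algebra_simps)

lemma linear_op_backward_diff: "linear_op (backward_diff p)"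
  by (auto simp: linear_op_def backward_diff_def shift_inv_def fscale_def fun_eq_iff algebra_simps)

lemma monomial_in_Suc:
  assumes "q \<in> I"
  shows "monomial_in I (\<nu>(q := Suc (\<nu> q))) = mult_var q (monomial_in I \<nu>)"
proof
  fix x :: "real^'a"
  have "(\<Prod>m\<in>I - {q}. x $ m ^ (\<nu>(q := Suc (\<nu> q))) m) = (\<Prod>m\<in>I - {q}. x $ m ^ \<nu> m)"
    by (intro prod.cong) auto
  then show "monomial_in I (\<nu>(q := Suc (\<nu> q))) x = mult_var q (monomial_in I \<nu>) x"
    using assms by (simp add: monomial_in_def mult_var_def prod.remove[of I q])
qed

lemma degree_Suc:
  fixes \<nu> :: "'n::finite \<Rightarrow> nat"
  assumes "q \<in> I"
  shows "(\<Sum>m\<in>I. (\<nu>(q := Suc (\<nu> q))) m) = Suc (\<Sum>m\<in>I. \<nu> m)"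
proof -
  have "(\<Sum>m\<in>I - {q}. (\<nu>(q := Suc (\<nu> q))) m) = (\<Sum>m\<in>I - {q}. \<nu> m)"
    by (intro sum.cong) auto
  then show ?thesis using assms by (simp add: sum.remove[of I q])
qed

text \<open>
  Induction on the degree of a monomial.  The predicate takes the degree and the monomial, and the
  step multiplies by one variable, so that product rules for operators apply directly.
\<close>

lemma monomial_in_induct [case_names degree_0 mult_var]:
  fixes \<nu> :: "'n::finite \<Rightarrow> nat"
  assumes "P 0 (\<lambda>x. 1)"
    and "\<And>k q \<nu>. q \<in> I \<Longrightarrow> (\<Sum>m\<in>I. \<nu> m) = k \<Longrightarrow> P k (monomial_in I \<nu>)
      \<Longrightarrow> P (Suc k) (mult_var q (monomial_in I \<nu>))"
  shows "P (\<Sum>m\<in>I. \<nu> m) (monomial_in I \<nu>)"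
proof (induction "\<Sum>m\<in>I. \<nu> m" arbitrary: \<nu>)
  case 0
  then have "monomial_in I \<nu> = (\<lambda>x. 1)" by (auto simp: monomial_in_def fun_eq_iff)
  with 0 assms(1) show ?case by simp
next
  case (Suc k)
  from Suc.hyps(2) have "(\<Sum>m\<in>I. \<nu> m) \<noteq> 0" by linarith
  then obtain q where q: "q \<in> I" "\<nu> q \<noteq> 0" by (metis sum.neutral)
  define \<mu> where "\<mu> = \<nu>(q := \<nu> q - 1)"
  have \<nu>: "\<nu> = \<mu>(q := Suc (\<mu> q))" using q by (auto simp: \<mu>_def fun_eq_iff)
  have \<mu>: "(\<Sum>m\<in>I. \<mu> m) = k" using Suc.hyps(2) degree_Suc[OF q(1), of \<mu>] \<nu> by simp
  show ?case
    using assms(2)[OF q(1) \<mu>] Suc.hyps(1)[OF \<mu>[symmetric]] \<mu> Suc.hyps(2)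
      monomial_in_Suc[OF q(1), of \<mu>] \<nu> by simp
qed

lemma mult_var_polys_less:
  assumes "q \<in> I" "f \<in> polys_less I k"
  shows "mult_var q f \<in> polys_less I (Suc k)"
  using assms degree_Suc[OF assms(1)]
  by (intro linear_op_polys_less[OF linear_op_mult_var _ assms(2)])
    (simp add: monomial_in_Suc[symmetric] monomial_in_polys_less del: fun_upd_apply)

text \<open>
  An operator obeying a product rule of the following shape lowers the degree; both differences
  are instances, with \<open>\<epsilon> = 1\<close> and \<open>\<epsilon> = -1\<close>.
\<close>

lemma difference_lowers_degree:
  assumes T: "linear_op T" and one: "T (\<lambda>x. 1) = 0"
    and prod: "\<And>q f. T (mult_var q f) = mult_var q (T f) + (if q = p then f + fscale \<epsilon> (T f) else 0)"
    and f: "f \<in> polys_less I (Suc k)"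
  shows "T f \<in> polys_less I k"
proof (rule linear_op_polys_less[OF T _ f])
  fix \<nu> :: "'a \<Rightarrow> nat" assume le: "(\<Sum>m\<in>I. \<nu> m) < Suc k"
  have "T (monomial_in I \<nu>) \<in> polys_less I (\<Sum>m\<in>I. \<nu> m)"
  proof (induction \<nu> rule: monomial_in_induct)
    case degree_0
    show ?case unfolding one polys_less_0 by (rule singletonI)
  next
    case (mult_var k q \<nu>)
    let ?g = "monomial_in I \<nu>"
    have "mult_var q (T ?g) \<in> polys_less I (Suc k)" "?g \<in> polys_less I (Suc k)"
      "T ?g \<in> polys_less I (Suc k)"
      using mult_var polys_less_mono[of k "Suc k" I]
      by (auto intro: mult_var_polys_less monomial_in_polys_less)
    then have "mult_var q (T ?g) + (if q = p then ?g + fscale \<epsilon> (T ?g) else 0) \<in> polys_less I (Suc k)"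
      by (auto intro!: polys_less_add polys_less_scale)
    then show ?case unfolding prod .
  qed
  then show "T (monomial_in I \<nu>) \<in> polys_less I k"
    using polys_less_mono[of "\<Sum>m\<in>I. \<nu> m" k I] le by auto
qed

lemma forward_diff_mult_var:
  "forward_diff p (mult_var q f)
    = mult_var q (forward_diff p f) + (if q = p then f + fscale 1 (forward_diff p f) else 0)"
  by (auto simp: forward_diff_def mult_var_def shift_def fscale_def fun_eq_iff axis_def
      algebra_simps)

lemma backward_diff_mult_var:
  "backward_diff p (mult_var q f)
    = mult_var q (backward_diff p f) + (if q = p then f + fscale (-1) (backward_diff p f) else 0)"
  by (auto simp: backward_diff_def mult_var_def shift_inv_def fscale_def fun_eq_iff axis_def
      algebra_simps)

lemma forward_diff_polys_less:
  "f \<in> polys_less I (Suc k) \<Longrightarrow> forward_diff p f \<in> polys_less I k"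
  by (rule difference_lowers_degree[OF linear_op_forward_diff _ forward_diff_mult_var])
    (auto simp: forward_diff_def shift_def fun_eq_iff)

lemma backward_diff_polys_less:
  "f \<in> polys_less I (Suc k) \<Longrightarrow> backward_diff p f \<in> polys_less I k"
  by (rule difference_lowers_degree[OF linear_op_backward_diff _ backward_diff_mult_var])
    (auto simp: backward_diff_def shift_inv_def fun_eq_iff)

text \<open>The discrete analogue of the Euler operator: it has leading part \<open>k\<close> in degree \<open>k\<close>.\<close>

definition discrete_euler :: "'n::finite set \<Rightarrow> 'n func \<Rightarrow> 'n func" where
  "discrete_euler I f = (\<Sum>p\<in>I. mult_var p (forward_diff p f))"

lemma linear_op_discrete_euler: "linear_op (discrete_euler I)"
  by (auto simp: linear_op_def discrete_euler_def mult_var_def forward_diff_def shift_def fscale_def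
      fun_eq_iff fun_sum_apply algebra_simps sum.distrib sum_subtractf sum_distrib_left)

lemma discrete_euler_mult_var:
  assumes "q \<in> I"
  shows "discrete_euler I (mult_var q f)
    = mult_var q (discrete_euler I f) + mult_var q (f + forward_diff q f)"
proof
  fix x
  have "(\<Sum>p\<in>I. x $ p * (if q = p then f x + forward_diff p f x else 0))
      = (\<Sum>p\<in>I. if p = q then x $ q * (f x + forward_diff q f x) else 0)"
    by (intro sum.cong) auto
  also have "\<dots> = x $ q * (f x + forward_diff q f x)"
    using assms by (simp add: sum.delta)
  finally have "(\<Sum>p\<in>I. x $ p * (if q = p then f x + forward_diff p f x else 0))
      = x $ q * (f x + forward_diff q f x)" .
  moreover have "forward_diff p (mult_var q f) x
      = x $ q * forward_diff p f x + (if q = p then f x + forward_diff p f x else 0)" for p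
    unfolding forward_diff_mult_var by (simp add: fscale_def mult_var_def)
  ultimately show "discrete_euler I (mult_var q f) x
      = (mult_var q (discrete_euler I f) + mult_var q (f + forward_diff q f)) x"
    by (simp add: discrete_euler_def fun_sum_apply mult_var_def distrib_left sum.distrib
        sum_distrib_left mult.left_commute)
qed

lemma discrete_euler_leading:
  assumes "f \<in> polys_less I (Suc k)"
  shows "discrete_euler I f - fscale (real k) f \<in> polys_less I k"
proof -
  let ?T = "\<lambda>k f. discrete_euler I f - fscale (real k) f"
  have T: "linear_op (?T k)" for k
    using linear_op_discrete_euler[of I]
    by (auto simp: linear_op_def fun_space.scale_right_distrib fun_space.scale_right_diff_distrib
        mult.commute)
  have "?T (\<Sum>m\<in>I. \<nu> m) (monomial_in I \<nu>) \<in> polys_less I (\<Sum>m\<in>I. \<nu> m)" for \<nu>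
  proof (induction \<nu> rule: monomial_in_induct)
    case degree_0
    show ?case
      by (simp add: discrete_euler_def forward_diff_def shift_def mult_var_def fscale_def
          fun_eq_iff fun_sum_apply)
  next
    case (mult_var k q \<nu>)
    let ?g = "monomial_in I \<nu>"
    have "?g \<in> polys_less I (Suc k)" using mult_var by (simp add: monomial_in_polys_less)
    then have "mult_var q (forward_diff q ?g) \<in> polys_less I (Suc k)"
      using mult_var by (intro mult_var_polys_less forward_diff_polys_less)
    moreover have "mult_var q (?T k ?g) \<in> polys_less I (Suc k)"
      using mult_var by (intro mult_var_polys_less)
    moreover have "?T (Suc k) (mult_var q ?g)
        = mult_var q (?T k ?g) + mult_var q (forward_diff q ?g)"
      unfolding discrete_euler_mult_var[OF mult_var(1)]
      by (auto simp: fun_eq_iff mult_var_def fscale_def algebra_simps)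
    ultimately show ?case by (metis polys_less_add)
  qed
  note monomial_case = this
  show ?thesis
  proof (rule linear_op_polys_less[OF T _ assms])
    fix \<nu> :: "'a \<Rightarrow> nat" assume le: "(\<Sum>m\<in>I. \<nu> m) < Suc k"
    define j where "j = (\<Sum>m\<in>I. \<nu> m)"
    show "?T k (monomial_in I \<nu>) \<in> polys_less I k"
    proof (cases "j = k")
      case True
      then show ?thesis using monomial_case[of \<nu>] by (simp add: j_def)
    next
      case False
      then have "j < k" using le by (simp add: j_def)
      then have "?T j (monomial_in I \<nu>) + fscale (real j - real k) (monomial_in I \<nu>) \<in> polys_less I k"
        using monomial_case[of \<nu>] polys_less_mono[of j k I]
        by (intro polys_less_add polys_less_scale monomial_in_polys_less) (auto simp: j_def)
      also have "?T j (monomial_in I \<nu>) + fscale (real j - real k) (monomial_in I \<nu>)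
          = ?T k (monomial_in I \<nu>)"
        by (auto simp: fun_eq_iff fscale_def algebra_simps)
      finally show ?thesis .
    qed
  qed
qed

section \<open>Triangular operators\<close>

text \<open>
  An operator is triangular on \<open>I\<close> if it acts on polynomials of degree at most \<open>k\<close> as
  multiplication by \<open>-k\<close>, modulo polynomials of degree less than \<open>k\<close>.
\<close>

definition triangular_on :: "'n::finite set \<Rightarrow> ('n func \<Rightarrow> 'n func) \<Rightarrow> bool" where
  "triangular_on I T \<longleftrightarrow> linear_op T \<and>
     (\<forall>k. \<forall>f\<in>polys_less I (Suc k). T f + fscale (real k) f \<in> polys_less I k)"

lemma triangular_no_lower_eigenfunctions:
  assumes T: "triangular_on I T" and u: "u \<in> polys_less I k" "T u = fscale (- real k) u"
  shows "u = 0"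
proof -
  \<comment> \<open>If \<open>u\<close> has degree at most \<open>a < k\<close>, then \<open>T u + a u\<close> has lower degree, but it equals
    \<open>(a - k) u\<close>; so the degree of \<open>u\<close> drops step by step until only \<open>u = 0\<close> is left.\<close>
  have "u \<in> polys_less I (k - j)" if "j \<le> k" for j
    using that
  proof (induction j)
    case 0
    then show ?case using u by simp
  next
    case (Suc j)
    define a where "a = k - Suc j"
    have a: "k - j = Suc a" "a < k" using Suc.prems by (auto simp: a_def)
    then have "T u + fscale (real a) u \<in> polys_less I a"
      using T Suc by (auto simp: triangular_on_def)
    then have "fscale (1 / (real a - real k)) (T u + fscale (real a) u) \<in> polys_less I a"
      by (rule polys_less_scale)
    also have "fscale (1 / (real a - real k)) (T u + fscale (real a) u) = u"
      using a(2) by (auto simp: u(2) fscale_def fun_eq_iff field_simps)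
    finally show ?case by (simp add: a_def)
  qed
  from this[of k] show ?thesis by simp
qed

lemma triangular_solve_lower:
  assumes T: "triangular_on I T" and v: "v \<in> polys_less I k"
  obtains w where "w \<in> polys_less I k" "T w + fscale (real k) w = v"
proof -
  have lin: "linear_op T" using T by (simp add: triangular_on_def)
  have "\<exists>w\<in>polys_less I j. T w + fscale (real k) w = v"
    if "j \<le> k" "v \<in> polys_less I j" for j v
    using that
  proof (induction j arbitrary: v)
    case 0
    then have "v = 0" by simp
    then show ?case
      using linear_op_zero[OF lin] by (metis add_0 fun_space.scale_zero_right polys_less_0 singletonI)
  next
    case (Suc j)
    \<comment> \<open>Dividing by the diagonal entry \<open>k - j\<close> solves the equation up to an error of lower degree.\<close>
    define w where "w = fscale (1 / (real k - real j)) v"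
    have w: "w \<in> polys_less I (Suc j)" using Suc.prems by (simp add: w_def polys_less_scale)
    have v: "fscale (real k - real j) w = v"
      using Suc.prems(1) by (auto simp: w_def fscale_def fun_eq_iff)
    have "T w + fscale (real j) w \<in> polys_less I j" using T w by (simp add: triangular_on_def)
    then have "\<exists>w'\<in>polys_less I j. T w' + fscale (real k) w' = T w + fscale (real j) w"
      by (rule Suc.IH[OF Suc_leD[OF Suc.prems(1)]])
    then obtain w' where w': "w' \<in> polys_less I j"
      "T w' + fscale (real k) w' = T w + fscale (real j) w" by blast
    have "T (w - w') + fscale (real k) (w - w')
        = (T w + fscale (real k) w) - (T w' + fscale (real k) w')"
      by (simp add: linear_op_diff[OF lin] fun_space.scale_right_diff_distrib)
    also have "\<dots> = fscale (real k - real j) w"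
      by (simp add: w'(2) fun_space.scale_left_diff_distrib)
    finally have "T (w - w') + fscale (real k) (w - w') = v" unfolding v .
    moreover have "w - w' \<in> polys_less I (Suc j)"
      using w w'(1) polys_less_mono[of j "Suc j" I] by (intro polys_less_diff) auto
    ultimately show ?case by (rule bexI)
  qed
  with v that show thesis by blast
qed

lemma triangular_eigenfunction:
  assumes T: "triangular_on I T" and deg: "(\<Sum>m\<in>I. \<nu> m) = k"
  obtains u where "T u = fscale (- real k) u" "u - monomial_in I \<nu> \<in> polys_less I k"
proof -
  let ?f = "monomial_in I \<nu>"
  have "?f \<in> polys_less I (Suc k)" using deg by (simp add: monomial_in_polys_less)
  then have "T ?f + fscale (real k) ?f \<in> polys_less I k" using T by (simp add: triangular_on_def)
  then obtain w where w: "w \<in> polys_less I k" "T w + fscale (real k) w = T ?f + fscale (real k) ?f"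
    using triangular_solve_lower[OF T] by metis
  have "linear_op T" using T by (simp add: triangular_on_def)
  then have "T (?f - w) = T ?f - T w" by (rule linear_op_diff)
  also have "\<dots> = fscale (- real k) (?f - w)"
    using w(2) by (auto simp: fun_eq_iff fscale_def algebra_simps)
  finally have "T (?f - w) = fscale (- real k) (?f - w)" .
  moreover have "?f - w - ?f \<in> polys_less I k"
    using polys_less_scale[OF w(1), of "-1"] by (simp add: fscale_def fun_Compl_def)
  ultimately show thesis using that by blast
qed

text \<open>
  The coefficient of a monomial in a polynomial; the value is \<open>0\<close> for functions that are not
  polynomials in the variables \<open>I\<close>.
\<close>

definition monomial_coeff :: "'n::finite set \<Rightarrow> ('n \<Rightarrow> nat) \<Rightarrow> 'n func \<Rightarrow> real" where
  "monomial_coeff I \<nu> f =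
     fun_space.representation (monomial_in I ` exponents I) f (monomial_in I \<nu>)"

lemma polys_less_subset_span: "polys_less I k \<subseteq> fun_space.span (monomial_in I ` exponents I)"
  unfolding polys_less_def
proof (rule fun_space.span_mono, safe)
  fix \<nu> show "monomial_in I \<nu> \<in> monomial_in I ` exponents I"
    by (rule monomial_in_normal_form[of I \<nu>]) auto
qed

lemma monomial_coeff_monomial_in:
  assumes "\<nu> \<in> exponents I" "\<mu> \<in> exponents I"
  shows "monomial_coeff I \<nu> (monomial_in I \<mu>) = (if \<nu> = \<mu> then 1 else 0)"
  using assms inj_on_monomial_in[of I] unfolding monomial_coeff_def
  by (subst fun_space.representation_basis[OF independent_monomials]) (auto simp: inj_on_eq_iff)

lemma monomial_coeff_polys_less:
  assumes f: "f \<in> polys_less I k" and \<nu>: "\<nu> \<in> exponents I" "k \<le> (\<Sum>m\<in>I. \<nu> m)"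
  shows "monomial_coeff I \<nu> f = 0"
proof (rule ccontr)
  let ?M = "monomial_in I ` {\<mu> \<in> exponents I. (\<Sum>m\<in>I. \<mu> m) < k}"
  have "{monomial_in I \<mu> | \<mu>. (\<Sum>m\<in>I. \<mu> m) < k} \<subseteq> ?M"
  proof safe
    fix \<mu> :: "'a \<Rightarrow> nat" assume "(\<Sum>m\<in>I. \<mu> m) < k"
    then show "monomial_in I \<mu> \<in> ?M" by (rule_tac monomial_in_normal_form[of I \<mu>]) auto
  qed
  then have "f \<in> fun_space.span ?M"
    using f fun_space.span_mono unfolding polys_less_def by blast
  then have "fun_space.representation (monomial_in I ` exponents I) f
      = fun_space.representation ?M f"
    by (intro fun_space.representation_extend[OF independent_monomials]) auto
  moreover assume "monomial_coeff I \<nu> f \<noteq> 0"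
  ultimately have "monomial_in I \<nu> \<in> ?M"
    by (auto simp: monomial_coeff_def dest: fun_space.representation_ne_zero)
  then show False
    using \<nu> inj_on_monomial_in[of I] by (auto simp: inj_on_eq_iff)
qed

lemma monomial_coeff_add:
  assumes "f \<in> polys_less I k" "g \<in> polys_less I k"
  shows "monomial_coeff I \<nu> (f + g) = monomial_coeff I \<nu> f + monomial_coeff I \<nu> g"
  using assms polys_less_subset_span[of I k] unfolding monomial_coeff_def
  by (subst fun_space.representation_add[OF independent_monomials]) auto

lemma monomial_coeff_sum_scale:
  assumes "\<And>u. u \<in> U \<Longrightarrow> u \<in> polys_less I k"
  shows "monomial_coeff I \<nu> (\<Sum>u\<in>U. fscale (c u) u) = (\<Sum>u\<in>U. c u * monomial_coeff I \<nu> u)"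
proof -
  let ?M = "monomial_in I ` exponents I"
  have span: "u \<in> fun_space.span ?M" if "u \<in> U" for u
    using assms[OF that] polys_less_subset_span[of I k] by auto
  have "monomial_coeff I \<nu> (\<Sum>u\<in>U. fscale (c u) u)
      = (\<Sum>u\<in>U. fun_space.representation ?M (fscale (c u) u) (monomial_in I \<nu>))"
    unfolding monomial_coeff_def
    by (subst fun_space.representation_sum[OF independent_monomials])
      (auto intro: fun_space.span_scale span)
  also have "\<dots> = (\<Sum>u\<in>U. c u * monomial_coeff I \<nu> u)"
    unfolding monomial_coeff_def
    by (intro sum.cong refl)
      (simp add: fun_space.representation_scale[OF independent_monomials span])
  finally show ?thesis .
qed

lemma triangular_admissible:
  assumes T: "triangular_on I T" and op: "difference_operator_in I T" and I: "I \<noteq> {}"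
  shows "admissible I T"
  unfolding admissible_def
proof (intro conjI op allI)
  fix k
  let ?N = "{\<nu> \<in> exponents I. (\<Sum>m\<in>I. \<nu> m) = k}"
  have "\<forall>\<nu>\<in>?N. \<exists>u. T u = fscale (- real k) u \<and> u - monomial_in I \<nu> \<in> polys_less I k"
  proof
    fix \<nu> assume "\<nu> \<in> ?N"
    then have "(\<Sum>m\<in>I. \<nu> m) = k" by blast
    then obtain u where "T u = fscale (- real k) u" "u - monomial_in I \<nu> \<in> polys_less I k"
      by (rule triangular_eigenfunction[OF T])
    then show "\<exists>u. T u = fscale (- real k) u \<and> u - monomial_in I \<nu> \<in> polys_less I k"
      by (intro exI conjI)
  qed
  then obtain u where
    u: "\<forall>\<nu>\<in>?N. T (u \<nu>) = fscale (- real k) (u \<nu>) \<and> u \<nu> - monomial_in I \<nu> \<in> polys_less I k"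
    by (rule bchoice[THEN exE])
  have eig: "T (u \<nu>) = fscale (- real k) (u \<nu>)"
    and lead: "u \<nu> - monomial_in I \<nu> \<in> polys_less I k" if "\<nu> \<in> ?N" for \<nu>
    by (rule conjunct1[OF bspec[OF u that]], rule conjunct2[OF bspec[OF u that]])
  have lead': "u \<nu> - monomial_in I \<nu> \<in> polys_less I (Suc k)" if "\<nu> \<in> ?N" for \<nu>
    using lead[OF that] polys_less_mono[of k "Suc k" I] by auto
  have mon: "monomial_in I \<nu> \<in> polys_less I (Suc k)" if "\<nu> \<in> ?N" for \<nu>
    using that by (simp add: monomial_in_polys_less)
  have mem: "u \<nu> \<in> polys_less I (Suc k)" if "\<nu> \<in> ?N" for \<nu>
    using polys_less_add[OF lead'[OF that] mon[OF that]] by simp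
  have coeff: "monomial_coeff I \<nu> (u \<mu>) = (if \<nu> = \<mu> then 1 else 0)"
    if "\<nu> \<in> ?N" "\<mu> \<in> ?N" for \<nu> \<mu>
  proof -
    have "monomial_coeff I \<nu> (u \<mu>)
        = monomial_coeff I \<nu> (u \<mu> - monomial_in I \<mu>) + monomial_coeff I \<nu> (monomial_in I \<mu>)"
      using monomial_coeff_add[OF lead'[OF that(2)] mon[OF that(2)], of \<nu>] by simp
    also have "monomial_coeff I \<nu> (u \<mu> - monomial_in I \<mu>) = 0"
      using that by (intro monomial_coeff_polys_less[OF lead]) auto
    finally show ?thesis using that by (simp add: monomial_coeff_monomial_in)
  qed
  have inj: "inj_on u ?N"
  proof (rule inj_onI)
    fix \<nu> \<mu> assume "\<nu> \<in> ?N" "\<mu> \<in> ?N" "u \<nu> = u \<mu>"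
    then show "\<nu> = \<mu>" using coeff[of \<nu> \<nu>] coeff[of \<nu> \<mu>] by (auto split: if_splits)
  qed
  have fin: "finite ?N" by (rule card_exponents_of_degree[OF I])
  have indep: "fun_space.independent (u ` ?N)"
  proof (rule fun_space.independent_if_scalars_zero)
    fix c f assume 0: "(\<Sum>f\<in>u ` ?N. fscale (c f) f) = 0" and "f \<in> u ` ?N"
    then obtain \<nu> where \<nu>: "\<nu> \<in> ?N" "f = u \<nu>" by blast
    have "0 = monomial_coeff I \<nu> (\<Sum>f\<in>u ` ?N. fscale (c f) f)"
      unfolding 0 by (simp add: monomial_coeff_def fun_space.representation_zero)
    also have "\<dots> = (\<Sum>f\<in>u ` ?N. c f * monomial_coeff I \<nu> f)"
      by (rule monomial_coeff_sum_scale[of _ _ "Suc k"]) (use mem in auto)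
    also have "\<dots> = (\<Sum>\<mu>\<in>?N. c (u \<mu>) * monomial_coeff I \<nu> (u \<mu>))"
      by (simp add: sum.reindex[OF inj])
    also have "\<dots> = (\<Sum>\<mu>\<in>?N. if \<nu> = \<mu> then c (u \<mu>) else 0)"
      using \<nu>(1) by (intro sum.cong) (simp_all add: coeff del: mem_Collect_eq)
    also have "\<dots> = c f" using \<nu> fin by (simp add: sum.delta')
    finally show "c f = 0" by simp
  qed (use fin in simp)
  have deg: "u \<nu> \<in> polys_of_degree I k" if "\<nu> \<in> ?N" for \<nu>
    using mem[OF that] coeff[OF that that] monomial_coeff_polys_less[of "u \<nu>" I k \<nu>] that
    by (auto simp: polys_of_degree_def)
  show "\<exists>\<mu>. (\<exists>U. finite U \<and> card U = (k + card I - 1) choose k \<and> fun_space.independent U \<and>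
          (\<forall>u\<in>U. u \<in> polys_of_degree I k \<and> T u = fscale \<mu> u)) \<and>
        (\<forall>u\<in>polys_less I k. T u = fscale \<mu> u \<longrightarrow> u = 0)"
  proof (intro exI[of _ "- real k"] conjI exI[of _ "u ` ?N"] ballI impI)
    show "card (u ` ?N) = (k + card I - 1) choose k"
      by (simp add: card_image[OF inj] card_exponents_of_degree[OF I])
    show "v = 0" if "v \<in> polys_less I k" "T v = fscale (- real k) v" for v
      using triangular_no_lower_eigenfunctions[OF T that] .
  qed (use fin indep deg eig in auto)
qed

section \<open>The blocks of the operator\<close>

text \<open>The block of \<open>D_op l s\<close> that involves the variables indexed by \<open>I\<close> only.\<close>

definition block_op ::
  "('n::finite \<Rightarrow> 'n \<Rightarrow> real) \<Rightarrow> ('n \<Rightarrow> real) \<Rightarrow> 'n set \<Rightarrow> 'n func \<Rightarrow> 'n func" where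
  "block_op l s I = (\<lambda>f x.
     (\<Sum>p\<in>I. \<Sum>q\<in>I. l p q * x $ q * forward_diff p (backward_diff q f) x)
     + (\<Sum>p\<in>I. (- (x $ p) + s p) * forward_diff p f x))"

lemma difference_operator_in_block_op: "difference_operator_in I (block_op l s I)"
  unfolding difference_operator_in_def block_op_def
  by (rule exI[of _ "\<lambda>p q x. l p q * x $ q"], rule exI[of _ "\<lambda>p x. - (x $ p) + s p"])
    (auto simp: depends_only_on_def)

lemma block_op_eq:
  "block_op l s I f = (\<Sum>p\<in>I. \<Sum>q\<in>I. fscale (l p q) (mult_var q (forward_diff p (backward_diff q f))))
     + (\<Sum>p\<in>I. fscale (s p) (forward_diff p f)) - discrete_euler I f"
  by (auto simp: block_op_def discrete_euler_def fun_eq_iff fun_sum_apply fscale_def mult_var_def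
      algebra_simps sum.distrib sum_subtractf sum_negf)

lemma linear_op_block_op: "linear_op (block_op l s I)"
  by (auto simp: linear_op_def block_op_def forward_diff_def backward_diff_def shift_def
      shift_inv_def fscale_def fun_eq_iff algebra_simps sum.distrib sum_subtractf sum_negf
      sum_distrib_left)

lemma triangular_block_op: "triangular_on I (block_op l s I)"
  unfolding triangular_on_def
proof (intro conjI linear_op_block_op allI ballI)
  fix k f assume f: "f \<in> polys_less I (Suc k)"
  have "mult_var q (forward_diff p (backward_diff q f)) \<in> polys_less I k" if "q \<in> I" for p q
  proof (cases k)
    case 0
    \<comment> \<open>Here \<open>f\<close> is constant, and the term vanishes instead of dropping in degree.\<close>
    then have "backward_diff q f = 0" using backward_diff_polys_less[OF f] by simp
    moreover have "mult_var q (forward_diff p 0) = 0"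
      by (simp only: linear_op_zero[OF linear_op_forward_diff] linear_op_zero[OF linear_op_mult_var])
    ultimately show ?thesis by (simp only: 0 polys_less_0 singleton_iff)
  next
    case (Suc j)
    with f that show ?thesis
      by (auto intro!: mult_var_polys_less forward_diff_polys_less backward_diff_polys_less)
  qed
  then have "(\<Sum>p\<in>I. \<Sum>q\<in>I. fscale (l p q) (mult_var q (forward_diff p (backward_diff q f))))
      + (\<Sum>p\<in>I. fscale (s p) (forward_diff p f))
      - (discrete_euler I f - fscale (real k) f) \<in> polys_less I k"
    using f by (intro polys_less_diff polys_less_add polys_less_sum polys_less_scale
        forward_diff_polys_less discrete_euler_leading)
  then show "block_op l s I f + fscale (real k) f \<in> polys_less I k"
    by (simp add: block_op_eq algebra_simps)
qed

lemma block_op_admissible: "I \<noteq> {} \<Longrightarrow> admissible I (block_op l s I)"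
  by (rule triangular_admissible[OF triangular_block_op difference_operator_in_block_op])

lemma D_op_split:
  assumes zero: "\<And>p q. p \<in> I \<Longrightarrow> q \<notin> I \<Longrightarrow> l p q = 0" "\<And>p q. p \<in> I \<Longrightarrow> q \<notin> I \<Longrightarrow> l q p = 0"
  shows "D_op l s = block_op l s I + block_op l s (UNIV - I)"
proof (intro ext)
  fix f :: "'a func" and x
  have split: "(\<Sum>p\<in>UNIV. g p) = (\<Sum>p\<in>I. g p) + (\<Sum>p\<in>UNIV - I. g p)" for g :: "'a \<Rightarrow> real"
    using sum.subset_diff[of I UNIV g] by simp
  let ?t = "\<lambda>p q. l p q * x $ q * forward_diff p (backward_diff q f) x"
  have "(\<Sum>p\<in>I. \<Sum>q\<in>UNIV - I. ?t p q) = 0" "(\<Sum>p\<in>UNIV - I. \<Sum>q\<in>I. ?t p q) = 0"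
    by (auto intro!: sum.neutral simp: zero)
  then have "(\<Sum>p\<in>UNIV. \<Sum>q\<in>UNIV. ?t p q)
      = (\<Sum>p\<in>I. \<Sum>q\<in>I. ?t p q) + (\<Sum>p\<in>UNIV - I. \<Sum>q\<in>UNIV - I. ?t p q)"
    unfolding split sum.distrib by simp
  then show "D_op l s f x = (block_op l s I + block_op l s (UNIV - I)) f x"
    unfolding D_op_def block_op_def
    by (simp add: split[of "\<lambda>p. (s p - x $ p) * forward_diff p f x"])
qed

section \<open>Consequences of compatibility\<close>

text \<open>
  Comparison of the coefficients of \<open>x\<^sub>k\<close> in \<open>l\<^sub>p\<^sub>q c\<^sub>p \<beta>\<^sub>q(x - e\<^sub>q) = l\<^sub>q\<^sub>p c\<^sub>q \<beta>\<^sub>p(x - e\<^sub>p)\<close>, where \<open>c\<close>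
  denotes the column sums of \<open>l\<close>.
\<close>

lemma compatibility_third_variable:
  assumes compat: "\<And>x. coeff_alpha l p q (x - axis p 1) * coeff_beta l s q (x - axis q 1) * coeff_gamma l p x
      = coeff_alpha l q p (x - axis q 1) * coeff_beta l s p (x - axis p 1) * coeff_gamma l q x"
    and ne: "p \<noteq> q" "k \<noteq> p" "k \<noteq> q"
  shows "l p q * (\<Sum>m\<in>UNIV. l m p) * l q k = l q p * (\<Sum>m\<in>UNIV. l m q) * l p k"
proof -
  have beta: "coeff_beta l s r (x + axis k 1) = coeff_beta l s r x + l r k" if "k \<noteq> r" for r x
  proof -
    have "(\<Sum>m\<in>UNIV - {r}. l r m * axis k 1 $ m) = (\<Sum>m\<in>UNIV - {r}. if m = k then l r k else 0)"
      by (intro sum.cong) (auto simp: axis_def)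
    also have "\<dots> = l r k" using that by (simp add: sum.delta)
    finally show ?thesis
      using that by (simp add: coeff_beta_def algebra_simps sum.distrib axis_def)
  qed
  \<comment> \<open>Evaluation at two points with \<open>x\<^sub>p = x\<^sub>q = 1\<close> that differ by \<open>e\<^sub>k\<close>.\<close>
  define x :: "real^'a" where "x = axis p 1 + axis q 1"
  have "- l p q * coeff_beta l s q (x - axis q 1) * (\<Sum>m\<in>UNIV. l m p)
      = - l q p * coeff_beta l s p (x - axis p 1) * (\<Sum>m\<in>UNIV. l m q)"
    using compat[of x] ne by (simp add: coeff_alpha_def coeff_gamma_def x_def axis_def)
  moreover have "- l p q * (coeff_beta l s q (x - axis q 1) + l q k) * (\<Sum>m\<in>UNIV. l m p)
      = - l q p * (coeff_beta l s p (x - axis p 1) + l p k) * (\<Sum>m\<in>UNIV. l m q)"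
  proof -
    have shift: "x + axis k 1 - axis r 1 = x - axis r 1 + axis k 1" for r
      by simp
    show ?thesis
      using compat[of "x + axis k 1"] ne unfolding shift beta[OF ne(2)] beta[OF ne(3)]
      by (simp add: coeff_alpha_def coeff_gamma_def x_def axis_def)
  qed
  ultimately show ?thesis by (simp add: algebra_simps)
qed

theorem theorem6p6:
  fixes l :: "'n::finite \<Rightarrow> 'n \<Rightarrow> real" and s :: "'n \<Rightarrow> real"
    and i j :: 'n and I J :: "'n set"
  assumes "CARD('n) > 1"
    and compat1: "\<And>p q x. p \<noteq> q \<Longrightarrow>
      coeff_alpha l p q (x - axis p 1) * coeff_beta l s q (x - axis q 1) * coeff_gamma l p x
      = coeff_alpha l q p (x - axis q 1) * coeff_beta l s p (x - axis p 1) * coeff_gamma l q x"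
    and compat2: "\<And>p q x. p \<noteq> q \<Longrightarrow>
      coeff_beta l s p (x - axis p 1) * coeff_beta l s q (x - axis p 1 - axis q 1)
        * coeff_gamma l q x * coeff_gamma l p (x - axis q 1)
      = coeff_beta l s q (x - axis q 1) * coeff_beta l s p (x - axis p 1 - axis q 1)
        * coeff_gamma l p x * coeff_gamma l q (x - axis p 1)"
    and gamma_nonzero: "\<And>p. \<exists>x. coeff_gamma l p x \<noteq> 0"
    and l_zero_sym: "\<And>p q. p \<noteq> q \<Longrightarrow> l p q = 0 \<longleftrightarrow> l q p = 0"
    and ij: "i \<noteq> j" "l i j = 0"
    and I_def: "I = {i} \<union> {m. l m i \<noteq> 0}"
    and J_def: "J = UNIV - I"
  shows "{j} \<subseteq> J \<and>
    (\<exists>D_I D_J. D_op l s = D_I + D_J \<and> admissible I D_I \<and> admissible J D_J)"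
proof -
  have "j \<in> J"
    using ij l_zero_sym[of i j] by (simp add: I_def J_def)
  have zero: "l m k = 0" if m: "m \<in> I" and k: "k \<notin> I" for m k
  proof (cases "m = i")
    case True
    then show ?thesis using k l_zero_sym[of k i] by (auto simp: I_def)
  next
    case False
    then have "l m i \<noteq> 0" "l i m \<noteq> 0" using m l_zero_sym[of m i] by (auto simp: I_def)
    moreover have "k \<noteq> i" "k \<noteq> m" "l i k = 0"
      using m k l_zero_sym[of k i] by (auto simp: I_def)
    moreover have "(\<Sum>n\<in>UNIV. l n i) \<noteq> 0"
      using gamma_nonzero[of i] by (auto simp: coeff_gamma_def)
    ultimately show ?thesis
      using compatibility_third_variable[OF compat1[OF False], of k] False by simp
  qed
  moreover have "l k m = 0" if "m \<in> I" "k \<notin> I" for m k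
    using zero[OF that] that l_zero_sym[of m k] by auto
  ultimately have "D_op l s = block_op l s I + block_op l s J"
    unfolding J_def by (rule D_op_split)
  moreover have "I \<noteq> {}" "J \<noteq> {}" using \<open>j \<in> J\<close> by (auto simp: I_def)
  ultimately show ?thesis using \<open>j \<in> J\<close> block_op_admissible by blast
qed

end
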